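(* Let $G$ be a simple connected graph with at least two vertices and let $v_i$ be a vertex of degree $d_i$. Then \[\mathcal{LE}_G(v_i)\leq\sqrt{\frac{1}{d_i}\sum_{w\in V:\,w\sim v_i}\frac{1}{d_w}}.\] Equality holds if and only if $G$ is a star and $v_i$ is its center.
   Context: $V$ is the vertex set, $w\sim v_i$ means $w$ is adjacent to $v_i$, $d_w$ is the degree of $w$. $A$ is the adjacency matrix, $D$ the diagonal degree matrix, $\mathcal{L}=I-D^{-1/2}AD^{-1/2}$ the normalized Laplacian. For a real symmetric matrix $B$, $|B|:=(B^2)^{1/2}$. The normalized Laplacian energy of a vertex is $\mathcal{LE}_G(v_i):=(|\mathcal{L}-I|)_{ii}$. *)

theory Defs
  imports "HOL-Analysis.Analysis"
begin

text \<open>A graph has the finite type 'n as its vertex set and is given by its adjacency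
  relation; matrices are indexed by the vertices.\<close>

definition simple_graph :: "('n::finite \<Rightarrow> 'n \<Rightarrow> bool) \<Rightarrow> bool" where
  "simple_graph E \<longleftrightarrow> symp E \<and> irreflp E"

definition connected_graph :: "('n::finite \<Rightarrow> 'n \<Rightarrow> bool) \<Rightarrow> bool" where
  "connected_graph E \<longleftrightarrow> (\<forall>u v. E\<^sup>*\<^sup>* u v)"

definition vertex_degree :: "('n::finite \<Rightarrow> 'n \<Rightarrow> bool) \<Rightarrow> 'n \<Rightarrow> nat" where
  "vertex_degree E v = card {w. E w v}"

text \<open>The complete bipartite graph with parts the singleton of c and all other vertices.
  In the star on two vertices each of the two vertices is a center.\<close>

definition star_with_center :: "('n::finite \<Rightarrow> 'n \<Rightarrow> bool) \<Rightarrow> 'n \<Rightarrow> bool" where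
  "star_with_center E c \<longleftrightarrow> (\<forall>u v. E u v \<longleftrightarrow> (u = c \<and> v \<noteq> c) \<or> (u \<noteq> c \<and> v = c))"

definition adjacency_matrix :: "('n::finite \<Rightarrow> 'n \<Rightarrow> bool) \<Rightarrow> real^'n^'n" where
  "adjacency_matrix E = (\<chi> i j. if E i j then 1 else 0)"

text \<open>The power \<open>D\<^sup>a\<close> of the diagonal degree matrix D; the case a = -1/2 is used, for graphs
  all of whose degrees are positive.\<close>

definition degree_matrix_powr :: "('n::finite \<Rightarrow> 'n \<Rightarrow> bool) \<Rightarrow> real \<Rightarrow> real^'n^'n" where
  "degree_matrix_powr E a = (\<chi> i j. if i = j then real (vertex_degree E i) powr a else 0)"

definition normalized_laplacian :: "('n::finite \<Rightarrow> 'n \<Rightarrow> bool) \<Rightarrow> real^'n^'n" where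
  "normalized_laplacian E =
     mat 1 - degree_matrix_powr E (-1/2) ** adjacency_matrix E ** degree_matrix_powr E (-1/2)"

definition positive_semidefinite :: "real^'n^'n \<Rightarrow> bool" where
  "positive_semidefinite M \<longleftrightarrow> transpose M = M \<and> (\<forall>x. 0 \<le> x \<bullet> (M *v x))"

text \<open>The principal square root; it exists and is unique when M is positive semidefinite,
  and the value is unspecified otherwise.\<close>

definition matrix_sqrt :: "real^'n^'n \<Rightarrow> real^'n^'n" where
  "matrix_sqrt M = (THE S. positive_semidefinite S \<and> S ** S = M)"

text \<open>For symmetric B only: then \<open>B ** B\<close> is positive semidefinite.\<close>

definition matrix_abs :: "real^'n^'n \<Rightarrow> real^'n^'n" where
  "matrix_abs B = matrix_sqrt (B ** B)"

definition normalized_laplacian_energy :: "('n::finite \<Rightarrow> 'n \<Rightarrow> bool) \<Rightarrow> 'n \<Rightarrow> real" where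
  "normalized_laplacian_energy E v = matrix_abs (normalized_laplacian E - mat 1) $ v $ v"

end

theory Submission
  imports Defs
begin

text \<open>Put \<open>B = \<L> - I\<close>, where \<open>\<L>\<close> is the normalized Laplacian, and \<open>S = |B|\<close>. Then
  \<open>S\<^sub>v\<^sub>v\<^sup>2 \<le> \<Sum>\<^sub>w S\<^sub>v\<^sub>w\<^sup>2 = (B\<^sup>2)\<^sub>v\<^sub>v\<close>, and the last entry is the radicand of the bound. Equality means
  that the basis vector at v is an eigenvector of S, equivalently of \<open>B\<^sup>2 = S\<^sup>2\<close> because S is
  positive semidefinite. As all entries of B are nonpositive, this says that no
  walk of length two leads from v to another vertex, so in a connected graph v is the center of
  a star. That S exists and is unique follows from an orthonormal eigenbasis of B.\<close>

section \<open>Eigenbases of self-adjoint maps\<close>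

text \<open>First-order condition at a minimum: a quadratic that vanishes at 0 with nonzero slope
  changes sign there.\<close>

lemma linear_coeff_zero_if_quadratic_nonneg:
  fixes a k :: real
  assumes "\<And>t. 0 \<le> 2 * t * a + t\<^sup>2 * k"
  shows "a = 0"
proof (rule ccontr)
  assume "a \<noteq> 0"
  \<comment> \<open>A step against the slope \<open>a\<close>, short enough that the linear term
    outweighs \<open>t\<^sup>2 * k\<close> for either sign of \<open>k\<close>; the
    \<open>+ 1\<close> keeps the denominator positive.\<close>
  define t where "t = - a / (\<bar>k\<bar> + 1)"
  have a: "a = - t * (\<bar>k\<bar> + 1)" by (simp add: t_def)
  have "2 * t * a + t\<^sup>2 * k = t\<^sup>2 * (k - 2 * \<bar>k\<bar> - 2)"
    unfolding a by (simp add: algebra_simps power2_eq_square)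
  moreover have "t\<^sup>2 > 0" using \<open>a \<noteq> 0\<close> by (simp add: t_def)
  then have "t\<^sup>2 * (k - 2 * \<bar>k\<bar> - 2) < 0" by (intro mult_pos_neg) auto
  ultimately show False using assms[of t] by linarith
qed

text \<open>A maximizer of the Rayleigh quotient over the unit sphere of \<open>W\<close> is an
  eigenvector.\<close>

lemma self_adjoint_eigenvector_exists:
  fixes f :: "'a::euclidean_space \<Rightarrow> 'a"
  assumes lin: "linear f" and sa: "\<And>x y. x \<bullet> f y = f x \<bullet> y"
    and W: "subspace W" and inv: "\<And>x. x \<in> W \<Longrightarrow> f x \<in> W" and ne: "z \<in> W" "z \<noteq> 0"
  obtains x c where "x \<in> W" "norm x = 1" "f x = c *\<^sub>R x"
proof -
  let ?K = "sphere 0 1 \<inter> W"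
  have "compact ?K" by (intro compact_Int_closed closed_subspace W compact_sphere)
  moreover have "z /\<^sub>R norm z \<in> ?K" using ne W by (auto simp: subspace_mul)
  then have "?K \<noteq> {}" by blast
  moreover have "continuous_on ?K (\<lambda>x. x \<bullet> f x)"
    by (intro continuous_intros linear_continuous_on linear_conv_bounded_linear[THEN iffD1] lin)
  ultimately obtain x where xK: "x \<in> ?K" and max: "\<And>y. y \<in> ?K \<Longrightarrow> y \<bullet> f y \<le> x \<bullet> f x"
    using continuous_attains_sup by metis
  have xW: "x \<in> W" and nx: "norm x = 1" using xK by auto
  define m where "m = x \<bullet> f x"
  \<comment> \<open>By maximality of \<open>m\<close> the form of \<open>g\<close> is nonnegative on
    \<open>W\<close>, and it vanishes at \<open>x\<close>. Varying \<open>x\<close> in the direction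
    \<open>g x\<close>, which stays in \<open>W\<close> by invariance, then forces
    \<open>g x = 0\<close>.\<close>
  define g where "g = (\<lambda>y. m *\<^sub>R y - f y)"
  have g_add: "g (p + t *\<^sub>R q) = g p + t *\<^sub>R g q" for p q t
    by (simp add: g_def linear_add[OF lin] linear_scale[OF lin] algebra_simps)
  have g_sa: "p \<bullet> g q = g p \<bullet> q" for p q
    by (simp add: g_def inner_diff sa)
  have gW: "g p \<in> W" if "p \<in> W" for p
    using that W inv by (simp add: g_def subspace_diff subspace_mul)
  have gx: "x \<bullet> g x = 0"
    using nx by (simp add: g_def inner_diff m_def norm_eq_1)
  have g_nonneg: "0 \<le> p \<bullet> g p" if "p \<in> W" for p
  proof (cases "p = 0")
    case False
    have "p /\<^sub>R norm p \<in> ?K" using that False W by (auto simp: subspace_mul)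
    from max[OF this] have "(p \<bullet> f p) / (norm p)\<^sup>2 \<le> m"
      by (simp add: linear_scale[OF lin] m_def power2_eq_square divide_simps)
    then show ?thesis
      using False
      by (simp add: g_def inner_diff_right divide_simps power2_norm_eq_inner mult.commute)
  qed auto
  have "g x \<bullet> g x = 0"
  proof (rule linear_coeff_zero_if_quadratic_nonneg)
    fix t
    have "0 \<le> (x + t *\<^sub>R g x) \<bullet> g (x + t *\<^sub>R g x)"
      by (intro g_nonneg subspace_add[OF W] subspace_mul[OF W] xW gW)
    also have "\<dots> = 2 * t * (g x \<bullet> g x) + t\<^sup>2 * (g x \<bullet> g (g x))"
      using g_sa[of x "g x"]
      by (simp add: g_add inner_add gx algebra_simps power2_eq_square)
    finally show "0 \<le> 2 * t * (g x \<bullet> g x) + t\<^sup>2 * (g x \<bullet> g (g x))" .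
  qed
  then have "f x = m *\<^sub>R x" by (simp add: g_def)
  with xW nx that show thesis by blast
qed

text \<open>An orthonormal set of eigenvectors of largest cardinality must span: otherwise its
  orthogonal complement is a nonzero invariant subspace and contains one more eigenvector.\<close>

lemma self_adjoint_orthonormal_eigenbasis:
  fixes f :: "'a::euclidean_space \<Rightarrow> 'a"
  assumes lin: "linear f" and sa: "\<And>x y. x \<bullet> f y = f x \<bullet> y"
  obtains B where "finite B" "pairwise orthogonal B" "\<And>b. b \<in> B \<Longrightarrow> norm b = 1"
    "\<And>b. b \<in> B \<Longrightarrow> \<exists>c. f b = c *\<^sub>R b" "span B = UNIV"
proof -
  define P where "P B \<longleftrightarrow> pairwise orthogonal B \<and> (\<forall>b\<in>B. norm b = 1 \<and> (\<exists>c. f b = c *\<^sub>R b))"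
    for B
  have fin: "finite B \<and> card B \<le> DIM('a)" if "P B" for B
  proof -
    have "0 \<notin> B" using that by (auto simp: P_def)
    then have "independent B" using that by (simp add: P_def pairwise_orthogonal_independent)
    then show ?thesis using independent_bound by blast
  qed
  have "P {}" by (simp add: P_def)
  moreover have "\<forall>B. P B \<longrightarrow> card B < DIM('a) + 1" using fin by fastforce
  ultimately obtain B where PB: "P B" and max: "\<And>C. P C \<Longrightarrow> card C \<le> card B"
    using ex_has_greatest_nat[of P "{}" card "DIM('a) + 1"] by blast
  have "span B = UNIV"
  proof (rule ccontr)
    assume "span B \<noteq> UNIV"
    then obtain z where z: "z \<noteq> 0" "\<And>x. x \<in> span B \<Longrightarrow> orthogonal z x"
      using orthogonal_to_subspace_exists_gen[of B UNIV] by (auto simp: psubset_eq)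
    define W where "W = {y. \<forall>b\<in>B. b \<bullet> y = 0}"
    have "subspace W" by (auto simp: W_def subspace_def inner_add_right)
    moreover have "f y \<in> W" if "y \<in> W" for y
      using that PB by (force simp: W_def P_def sa)
    moreover have "z \<in> W"
      using z(2) by (auto simp: W_def span_base orthogonal_def inner_commute)
    ultimately obtain x c where x: "x \<in> W" "norm x = 1" "f x = c *\<^sub>R x"
      using self_adjoint_eigenvector_exists[OF lin sa _ _ _ z(1)] by blast
    have "x \<notin> B" using x by (auto simp: W_def)
    have "P (insert x B)"
      using PB x by (auto simp: P_def W_def pairwise_insert orthogonal_def inner_commute)
    then have "card (insert x B) \<le> card B" by (rule max)
    then show False using \<open>x \<notin> B\<close> fin[OF PB] by simp
  qed
  with that PB fin show thesis unfolding P_def by blast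
qed

section \<open>The absolute value of a symmetric matrix\<close>

lemma symmetric_matrix_self_adjoint:
  fixes B :: "real^'n^'n"
  assumes "transpose B = B"
  shows "x \<bullet> (B *v y) = (B *v x) \<bullet> y"
  using assms by (metis dot_lmul_matrix vector_transpose_matrix)

text \<open>The square of \<open>S\<close> determines \<open>S\<close> on its eigenvectors. This
  serves both the uniqueness of the square root and the equality case of the bound.\<close>

lemma positive_semidefinite_eigenvector_of_square:
  fixes S :: "real^'n^'n"
  assumes S: "positive_semidefinite S" and x: "(S ** S) *v x = c *\<^sub>R x" and "0 \<le> c"
  shows "S *v x = sqrt c *\<^sub>R x"
proof -
  have sa: "p \<bullet> (S *v q) = (S *v p) \<bullet> q" for p q
    using S by (simp add: positive_semidefinite_def symmetric_matrix_self_adjoint)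
  have SS: "S *v (S *v x) = c *\<^sub>R x"
    using x by (simp add: matrix_vector_mul_assoc)
  show ?thesis
  proof (cases "c = 0")
    case True
    then have "(S *v x) \<bullet> (S *v x) = 0" using SS sa[of x "S *v x"] by simp
    then show ?thesis using True by simp
  next
    case False
    \<comment> \<open>Since \<open>(S + sqrt c) (S - sqrt c) x = 0\<close>, a nonzero
      \<open>y\<close> would be an eigenvector of \<open>S\<close> for the negative value
      \<open>- sqrt c\<close>.\<close>
    define y where "y = S *v x - sqrt c *\<^sub>R x"
    have "S *v y = - sqrt c *\<^sub>R y"
      using SS \<open>0 \<le> c\<close>
      by (simp add: y_def matrix_vector_mult_diff_distrib matrix_vector_mult_scaleR algebra_simps)
    moreover have "0 \<le> y \<bullet> (S *v y)" using S by (simp add: positive_semidefinite_def)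
    ultimately have "sqrt c * (y \<bullet> y) \<le> 0" by simp
    moreover have "sqrt c > 0" using False \<open>0 \<le> c\<close> by simp
    ultimately have "y \<bullet> y \<le> 0" by (simp add: mult_le_0_iff)
    then have "y = 0" using inner_ge_zero[of y] inner_eq_zero_iff[of y] by linarith
    then show ?thesis by (simp add: y_def)
  qed
qed

text \<open>The description by \<open>THE\<close> yields these properties once existence and
  uniqueness are known. Existence comes from replacing the eigenvalues of \<open>B\<close> by their
  absolute values on an eigenbasis; uniqueness holds because every candidate acts on that basis in
  the same way.\<close>

lemma matrix_abs_symmetric:
  fixes B :: "real^'n^'n"
  assumes sym: "transpose B = B"
  shows "positive_semidefinite (matrix_abs B)" and "matrix_abs B ** matrix_abs B = B ** B"
proof -
  obtain U where U: "finite U" "pairwise orthogonal U" "\<And>b. b \<in> U \<Longrightarrow> norm b = 1"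
    "\<And>b. b \<in> U \<Longrightarrow> \<exists>c. B *v b = c *\<^sub>R b" and span: "span U = UNIV"
    using self_adjoint_orthonormal_eigenbasis[of "(*v) B"] symmetric_matrix_self_adjoint[OF sym]
    by (metis matrix_vector_mul_linear)
  from U(4) obtain c where c: "\<And>b. b \<in> U \<Longrightarrow> B *v b = c b *\<^sub>R b" by metis
  have BB: "(B ** B) *v b = (c b)\<^sup>2 *\<^sub>R b" if "b \<in> U" for b
    using c[OF that]
    by (simp add: matrix_vector_mul_assoc[symmetric] matrix_vector_mult_scaleR power2_eq_square)
  have eq_on_U: "P = Q" if "\<And>b. b \<in> U \<Longrightarrow> P *v b = Q *v b" for P Q :: "real^'n^'n"
  proof -
    have "P *v x = Q *v x" for x
      by (rule linear_eq_on[of "(*v) P" "(*v) Q" x U]) (use that span in auto)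
    then show ?thesis by (simp add: matrix_eq)
  qed
  \<comment> \<open>The spectral formula for |B|: the sum of the projections onto the
    \<open>b\<close> in \<open>U\<close>, weighted by \<open>\<bar>c b\<bar>\<close>.\<close>
  define h where "h x = (\<Sum>b\<in>U. (\<bar>c b\<bar> * (b \<bullet> x)) *\<^sub>R b)" for x :: "real^'n"
  have "linear h"
    by (rule linearI)
      (simp_all add: h_def inner_add_right algebra_simps sum.distrib scaleR_sum_right)
  then have hv: "matrix h *v x = h x" for x by simp
  have h_sa: "x \<bullet> h y = h x \<bullet> y" for x y
    by (simp add: h_def inner_sum_left inner_sum_right mult_ac inner_commute)
  have h_U: "h b = \<bar>c b\<bar> *\<^sub>R b" if "b \<in> U" for b
  proof -
    have "h b = (\<Sum>a\<in>U. if a = b then \<bar>c b\<bar> *\<^sub>R b else 0)"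
      unfolding h_def
      using U(2,3) that
      by (intro sum.cong) (auto simp: pairwise_def orthogonal_def norm_eq_1)
    then show ?thesis using U(1) that by simp
  qed
  have "positive_semidefinite (matrix h)"
  proof -
    have "x \<bullet> (transpose (matrix h) *v y) = x \<bullet> (matrix h *v y)" for x y
      by (metis dot_lmul_matrix h_sa hv inner_commute vector_transpose_matrix transpose_transpose)
    then have "transpose (matrix h) = matrix h"
      by (metis matrix_eq vector_eq_ldot)
    moreover have "x \<bullet> h x = (\<Sum>b\<in>U. \<bar>c b\<bar> * (b \<bullet> x)\<^sup>2)" for x
      by (simp add: h_def inner_sum_right power2_eq_square mult_ac inner_commute)
    then have "0 \<le> x \<bullet> h x" for x by (simp add: sum_nonneg)
    ultimately show ?thesis by (simp add: positive_semidefinite_def hv)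
  qed
  moreover have "matrix h ** matrix h = B ** B"
  proof (rule eq_on_U)
    fix b assume "b \<in> U"
    then have "(matrix h ** matrix h) *v b = (c b)\<^sup>2 *\<^sub>R b"
      by (simp add: matrix_vector_mul_assoc[symmetric] hv h_U linear_scale[OF \<open>linear h\<close>]
          power2_eq_square)
    then show "(matrix h ** matrix h) *v b = (B ** B) *v b" using BB \<open>b \<in> U\<close> by simp
  qed
  moreover have "S = T"
    if "positive_semidefinite S \<and> S ** S = B ** B" "positive_semidefinite T \<and> T ** T = B ** B"
    for S T
  proof (rule eq_on_U)
    fix b assume "b \<in> U"
    \<comment> \<open>Any root scales \<open>b\<close> by the nonnegative root of the eigenvalue
      \<open>(c b)\<^sup>2\<close> of \<open>B ** B\<close>.\<close>
    have "R *v b = sqrt ((c b)\<^sup>2) *\<^sub>R b"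
      if "positive_semidefinite R \<and> R ** R = B ** B" for R
      using that BB[OF \<open>b \<in> U\<close>] by (intro positive_semidefinite_eigenvector_of_square) auto
    then show "S *v b = T *v b" using that by simp
  qed
  ultimately have "\<exists>!S. positive_semidefinite S \<and> S ** S = B ** B" by blast
  from theI'[OF this] show "positive_semidefinite (matrix_abs B)"
    and "matrix_abs B ** matrix_abs B = B ** B"
    by (simp_all add: matrix_abs_def matrix_sqrt_def)
qed

text \<open>Used to carry the vanishing of off-diagonal entries between \<open>S\<close> and
  \<open>S ** S\<close> by way of eigenvectors.\<close>

lemma matrix_vector_mult_axis_eq_scaleR_iff:
  fixes M :: "real^'n^'n"
  shows "M *v axis v 1 = (M $ v $ v) *\<^sub>R axis v 1 \<longleftrightarrow> (\<forall>u. u \<noteq> v \<longrightarrow> M $ u $ v = 0)"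
proof -
  have "(M *v axis v 1) $ u = M $ u $ v" for u
    by (simp add: matrix_vector_mult_basis column_def)
  then show ?thesis by (auto simp: vec_eq_iff axis_def)
qed

lemma matrix_abs_diagonal_entry:
  fixes B :: "real^'n^'n"
  assumes sym: "transpose B = B"
  shows "matrix_abs B $ v $ v \<le> sqrt ((B ** B) $ v $ v)"
    and "matrix_abs B $ v $ v = sqrt ((B ** B) $ v $ v) \<longleftrightarrow> (\<forall>u. u \<noteq> v \<longrightarrow> (B ** B) $ u $ v = 0)"
proof -
  define S where "S = matrix_abs B"
  have psd: "positive_semidefinite S" and SS: "S ** S = B ** B"
    using matrix_abs_symmetric[OF sym] by (simp_all add: S_def)
  have S_sym: "S $ i $ j = S $ j $ i" for i j
  proof -
    have "transpose S $ i $ j = S $ i $ j" using psd by (simp add: positive_semidefinite_def)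
    then show ?thesis by (simp add: transpose_def)
  qed
  \<comment> \<open>By symmetry of \<open>S\<close>, this entry of \<open>S ** S\<close> is the
    squared norm of column \<open>v\<close>; the diagonal term is split off.\<close>
  have diag: "(B ** B) $ v $ v = (S $ v $ v)\<^sup>2 + (\<Sum>w\<in>UNIV - {v}. (S $ w $ v)\<^sup>2)"
  proof -
    have "(B ** B) $ v $ v = (\<Sum>w\<in>UNIV. S $ v $ w * S $ w $ v)"
      unfolding SS[symmetric] by (simp add: matrix_matrix_mult_def)
    also have "\<dots> = (\<Sum>w\<in>UNIV. (S $ w $ v)\<^sup>2)"
    proof (rule sum.cong)
      fix w
      show "S $ v $ w * S $ w $ v = (S $ w $ v)\<^sup>2"
        unfolding power2_eq_square by (subst S_sym) (rule refl)
    qed simp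
    finally show ?thesis using sum.remove[of UNIV v "\<lambda>w. (S $ w $ v)\<^sup>2"] by simp
  qed
  then have "(S $ v $ v)\<^sup>2 \<le> (B ** B) $ v $ v" by (simp add: sum_nonneg)
  then show "matrix_abs B $ v $ v \<le> sqrt ((B ** B) $ v $ v)"
    by (simp add: S_def real_le_rsqrt)
  show "matrix_abs B $ v $ v = sqrt ((B ** B) $ v $ v) \<longleftrightarrow> (\<forall>u. u \<noteq> v \<longrightarrow> (B ** B) $ u $ v = 0)"
    unfolding S_def[symmetric]
  proof
    assume "S $ v $ v = sqrt ((B ** B) $ v $ v)"
    moreover have "0 \<le> (B ** B) $ v $ v" using diag by (simp add: sum_nonneg)
    ultimately have "(S $ v $ v)\<^sup>2 = (B ** B) $ v $ v" by (simp only: real_sqrt_pow2)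
    \<comment> \<open>Equality leaves nothing for the other entries of the column, so the basis
      vector at \<open>v\<close> is an eigenvector of \<open>S\<close>, hence of its square.\<close>
    with diag have "(\<Sum>w\<in>UNIV - {v}. (S $ w $ v)\<^sup>2) = 0" by simp
    then have "\<forall>u. u \<noteq> v \<longrightarrow> S $ u $ v = 0" by (simp add: sum_nonneg_eq_0_iff)
    then have "S *v axis v 1 = (S $ v $ v) *\<^sub>R axis v 1"
      by (simp add: matrix_vector_mult_axis_eq_scaleR_iff)
    then have "(S ** S) *v axis v 1 = (S $ v $ v)\<^sup>2 *\<^sub>R axis v 1"
      by (simp add: matrix_vector_mul_assoc[symmetric] matrix_vector_mult_scaleR power2_eq_square)
    then have "(B ** B) *v axis v 1 = ((B ** B) $ v $ v) *\<^sub>R axis v 1"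
      using \<open>(S $ v $ v)\<^sup>2 = (B ** B) $ v $ v\<close> by (simp only: SS)
    then show "\<forall>u. u \<noteq> v \<longrightarrow> (B ** B) $ u $ v = 0"
      by (simp only: matrix_vector_mult_axis_eq_scaleR_iff)
  next
    assume "\<forall>u. u \<noteq> v \<longrightarrow> (B ** B) $ u $ v = 0"
    then have "(S ** S) *v axis v 1 = ((B ** B) $ v $ v) *\<^sub>R axis v 1"
      by (simp add: SS matrix_vector_mult_axis_eq_scaleR_iff)
    \<comment> \<open>The converse direction needs positivity of \<open>S\<close> to pass from the
      square back to \<open>S\<close>.\<close>
    then have "S *v axis v 1 = sqrt ((B ** B) $ v $ v) *\<^sub>R axis v 1"
      using positive_semidefinite_eigenvector_of_square[OF psd] diag by (simp add: sum_nonneg)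
    then have "(S *v axis v 1) $ v = (sqrt ((B ** B) $ v $ v) *\<^sub>R axis v 1) $ v" by simp
    then show "S $ v $ v = sqrt ((B ** B) $ v $ v)"
      by (simp add: matrix_vector_mult_basis column_def)
  qed
qed

section \<open>The normalized Laplacian of a connected graph\<close>

text \<open>The last edge of a walk to \<open>v\<close> from another vertex provides a
  neighbor.\<close>

lemma connected_graph_vertex_degree_pos:
  fixes E :: "'n::finite \<Rightarrow> 'n \<Rightarrow> bool"
  assumes "connected_graph E" and "CARD('n) \<ge> 2"
  shows "0 < vertex_degree E v"
proof -
  obtain u where "u \<noteq> v"
    using assms(2) card_mono[of "{v}" UNIV] by fastforce
  moreover have "E\<^sup>*\<^sup>* u v" using assms(1) by (simp add: connected_graph_def)
  ultimately obtain w where "E w v" by (metis rtranclp.cases)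
  then show ?thesis by (auto simp: vertex_degree_def card_gt_0_iff)
qed

text \<open>The identity cancels, and the two diagonal factors scale the rows and columns of the
  adjacency matrix.\<close>

lemma normalized_laplacian_minus_id_entry:
  fixes E :: "'n::finite \<Rightarrow> 'n \<Rightarrow> bool"
  shows "(normalized_laplacian E - mat 1) $ i $ j =
     (if E i j then - (real (vertex_degree E i) powr (-1/2) * real (vertex_degree E j) powr (-1/2))
      else 0)"
proof -
  let ?D = "degree_matrix_powr E (-1/2)" and ?d = "\<lambda>w. real (vertex_degree E w) powr (-1/2)"
  have left: "(?D ** M) $ i $ j = ?d i * M $ i $ j" for M :: "real^'n^'n" and i j
  proof -
    have "(?D ** M) $ i $ j = (\<Sum>w\<in>UNIV. if i = w then ?d i * M $ w $ j else 0)"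
      unfolding matrix_matrix_mult_def degree_matrix_powr_def vec_lambda_beta
      by (intro sum.cong) auto
    then show ?thesis by simp
  qed
  have right: "(M ** ?D) $ i $ j = M $ i $ j * ?d j" for M :: "real^'n^'n" and i j
  proof -
    have "(M ** ?D) $ i $ j = (\<Sum>w\<in>UNIV. if w = j then M $ i $ w * ?d w else 0)"
      unfolding matrix_matrix_mult_def degree_matrix_powr_def vec_lambda_beta
      by (intro sum.cong) auto
    then show ?thesis by simp
  qed
  have "(normalized_laplacian E - mat 1) $ i $ j = - (?D ** adjacency_matrix E ** ?D) $ i $ j"
    by (simp add: normalized_laplacian_def)
  then show ?thesis by (simp only: left right adjacency_matrix_def vec_lambda_beta) simp
qed

lemma transpose_normalized_laplacian_minus_id:
  assumes "simple_graph E"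
  shows "transpose (normalized_laplacian E - mat 1) = normalized_laplacian E - mat 1"
proof -
  have "E i j \<longleftrightarrow> E j i" for i j
    using assms by (auto simp: simple_graph_def dest: sympD)
  then show ?thesis
    by (simp add: vec_eq_iff transpose_def normalized_laplacian_minus_id_entry mult.commute
        del: vector_minus_component)
qed

text \<open>Identifies the radicand: each closed walk v, w, v contributes the square of one entry,
  in which the signs cancel.\<close>

lemma normalized_laplacian_minus_id_square_diagonal:
  assumes "simple_graph E"
  shows "((normalized_laplacian E - mat 1) ** (normalized_laplacian E - mat 1)) $ v $ v =
    1 / real (vertex_degree E v) * (\<Sum>w\<in>{w. E w v}. 1 / real (vertex_degree E w))"
proof -
  have sym: "E i j \<longleftrightarrow> E j i" for i j
    using assms by (auto simp: simple_graph_def dest: sympD)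
  \<comment> \<open>At \<open>d = 0\<close> both sides are 0, by the conventions
    \<open>0 powr a = 0\<close> and \<open>1 / 0 = 0\<close>.\<close>
  have sq: "real d powr (-1/2) * real d powr (-1/2) = 1 / real d" for d
    by (simp add: powr_minus_divide flip: powr_add)
  have prod: "(real a powr (-1/2) * real b powr (-1/2)) * (real b powr (-1/2) * real a powr (-1/2))
      = 1 / real a * (1 / real b)" for a b
    by (metis sq mult.assoc mult.commute)
  have "((normalized_laplacian E - mat 1) ** (normalized_laplacian E - mat 1)) $ v $ v =
    (\<Sum>w\<in>UNIV. if E w v then 1 / real (vertex_degree E v) * (1 / real (vertex_degree E w)) else 0)"
    unfolding matrix_matrix_mult_def vec_lambda_beta normalized_laplacian_minus_id_entry
    using sym[of v] prod by (intro sum.cong) auto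
  also have "\<dots> = (\<Sum>w\<in>{w. E w v}. 1 / real (vertex_degree E v) * (1 / real (vertex_degree E w)))"
    by (simp add: sum.If_cases)
  finally show ?thesis by (simp only: sum_distrib_left)
qed

text \<open>All entries of the factor are nonpositive, so the walks u, w, v cannot cancel each
  other; positive degrees make the entry of every edge nonzero.\<close>

lemma normalized_laplacian_minus_id_square_eq_0_iff:
  fixes E :: "'n::finite \<Rightarrow> 'n \<Rightarrow> bool"
  assumes "connected_graph E" and "CARD('n) \<ge> 2"
  shows "((normalized_laplacian E - mat 1) ** (normalized_laplacian E - mat 1)) $ u $ v = 0
    \<longleftrightarrow> \<not> (\<exists>w. E u w \<and> E w v)"
proof -
  let ?N = "normalized_laplacian E - mat 1"
  have pos: "0 < real (vertex_degree E w) powr (-1/2)" for w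
    using connected_graph_vertex_degree_pos[OF assms, of w] by simp
  have "(?N ** ?N) $ u $ v = (\<Sum>w\<in>UNIV. ?N $ u $ w * ?N $ w $ v)"
    by (simp only: matrix_matrix_mult_def vec_lambda_beta)
  moreover have "0 \<le> ?N $ u $ w * ?N $ w $ v" for w
    unfolding normalized_laplacian_minus_id_entry by auto
  moreover have "?N $ u $ w * ?N $ w $ v = 0 \<longleftrightarrow> \<not> (E u w \<and> E w v)" for w
    using pos[of u] pos[of v] pos[of w] unfolding normalized_laplacian_minus_id_entry by auto
  ultimately show ?thesis by (simp add: sum_nonneg_eq_0_iff del: vector_minus_component)
qed

lemma star_with_center_iff_no_two_step_walk:
  assumes "simple_graph E" and "connected_graph E"
  shows "star_with_center E v \<longleftrightarrow> (\<forall>u. u \<noteq> v \<longrightarrow> \<not> (\<exists>w. E u w \<and> E w v))"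
proof
  assume "star_with_center E v"
  then show "\<forall>u. u \<noteq> v \<longrightarrow> \<not> (\<exists>w. E u w \<and> E w v)" by (auto simp: star_with_center_def)
next
  assume walk: "\<forall>u. u \<noteq> v \<longrightarrow> \<not> (\<exists>w. E u w \<and> E w v)"
  have sym: "E i j \<longleftrightarrow> E j i" and irr: "\<not> E i i" for i j
    using assms(1) by (auto simp: simple_graph_def dest: sympD irreflpD)
  \<comment> \<open>Along a walk from \<open>v\<close>, leaving the set of \<open>v\<close> and its
    neighbors would give a forbidden walk of length two.\<close>
  have adj: "u = v \<or> E u v" for u
  proof -
    have "E\<^sup>*\<^sup>* v u" using assms(2) by (simp add: connected_graph_def)
    then show ?thesis by (induction rule: rtranclp_induct) (use sym walk in blast)+
  qed
  \<comment> \<open>An edge between two vertices other than \<open>v\<close> is excluded too: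
    \<open>w\<close> is adjacent to \<open>v\<close>, so u, w, v would be a forbidden walk.\<close>
  have "E u w \<longleftrightarrow> (u = v \<and> w \<noteq> v) \<or> (u \<noteq> v \<and> w = v)" for u w
    using adj[of u] adj[of w] sym irr walk by blast
  then show "star_with_center E v" by (simp add: star_with_center_def)
qed

theorem theorem4p2:
  fixes E :: "'n::finite \<Rightarrow> 'n \<Rightarrow> bool" and v :: 'n
  assumes "simple_graph E" and "connected_graph E" and "CARD('n) \<ge> 2"
  shows "normalized_laplacian_energy E v
           \<le> sqrt (1 / real (vertex_degree E v) * (\<Sum>w\<in>{w. E w v}. 1 / real (vertex_degree E w)))
       \<and> (normalized_laplacian_energy E v
           = sqrt (1 / real (vertex_degree E v) * (\<Sum>w\<in>{w. E w v}. 1 / real (vertex_degree E w)))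
          \<longleftrightarrow> star_with_center E v)"
  \<comment> \<open>The bound and equality criterion for diagonal entries of |B| become the two
    claims once the entries of the square are read as radicand and as two-step walks.\<close>
  using matrix_abs_diagonal_entry[OF transpose_normalized_laplacian_minus_id[OF assms(1)], of v]
  unfolding normalized_laplacian_energy_def
    normalized_laplacian_minus_id_square_diagonal[OF assms(1)]
    normalized_laplacian_minus_id_square_eq_0_iff[OF assms(2,3)]
    star_with_center_iff_no_two_step_walk[OF assms(1,2)]
  by blast

end
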